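(* The Pappus-Steiner system $\pi$ has no points of period $4$ over $\mathbb{Q}$. Moreover, for all sufficiently large primes $p$ (i.e. there is an integer $N$ such that for all primes $p>N$), $\pi$ has a point of period $4$ over $\mathbb{F}_p$ if and only if $$p\equiv 1,4 \pmod{5}\quad\text{or}\quad p\equiv 1,4,13,16\pmod{17}.$$
   Context: For a field $k$, the Pappus-Steiner map is the partially defined map $\pi$ on $k^2$ given by $\pi([x,y])=\left[\frac{2y(y-x+2)}{(x-y)^2},\frac{y^2}{(x-y)^2}\right]$, defined for $x\neq y$. Let $W_1=\{[x,y]\in k^2: x=y\}$ and inductively $W_n=\{[x,y]\in k^2\setminus\bigcup_{i=1}^{n-1}W_i:\ \pi([x,y])\in W_{n-1}\}$ for $n\geq 2$. Put $\mathbb{A}=k^2\setminus\bigcup_{i\ge 1}W_i$; this is the set of points at which all iterates of $\pi$ are defined, and $\pi$ restricts to a map $\mathbb{A}\to\mathbb{A}$. The period of a point $z\in\mathbb{A}$ is the smallest integer $n>0$ with $\pi^n(z)=z$ (if one exists). "A point of period $n$ over $k$" means a point of $\mathbb{A}$ (formed with the field $k$) having period $n$. *)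

theory Defs
  imports "HOL-Number_Theory.Residues" "HOL-Algebra.Algebraic_Closure_Type"
begin

text \<open>
  The field \<open>k\<close> is a \<open>HOL-Algebra\<close> record, because the finite field with \<open>p\<close> elements,
  \<^term>\<open>residue_ring (int p)\<close>, must be available under a quantifier over \<open>p\<close>. The field of
  rational numbers is \<^term>\<open>ring_of_type_algebra :: rat ring\<close>.
\<close>

text \<open>
  The map is total as a HOL function; its value is meaningful only for \<open>x \<noteq> y\<close>. It is only
  ever used off the diagonal: points of the diagonal are \<open>PS_W k 1\<close>, so they are
  removed before the map is applied in \<open>PS_W k n\<close> for \<open>n \<ge> 2\<close>, and they are not in \<open>PS_A k\<close>.
\<close>

definition pappus_steiner :: "('a, 'b) ring_scheme \<Rightarrow> 'a \<times> 'a \<Rightarrow> 'a \<times> 'a" where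
  "pappus_steiner k = (\<lambda>(x, y).
     (((\<one>\<^bsub>k\<^esub> \<oplus>\<^bsub>k\<^esub> \<one>\<^bsub>k\<^esub>) \<otimes>\<^bsub>k\<^esub> y \<otimes>\<^bsub>k\<^esub> ((y \<ominus>\<^bsub>k\<^esub> x) \<oplus>\<^bsub>k\<^esub> (\<one>\<^bsub>k\<^esub> \<oplus>\<^bsub>k\<^esub> \<one>\<^bsub>k\<^esub>)))
         \<otimes>\<^bsub>k\<^esub> inv\<^bsub>k\<^esub> ((x \<ominus>\<^bsub>k\<^esub> y) [^]\<^bsub>k\<^esub> (2::nat)),
      (y [^]\<^bsub>k\<^esub> (2::nat)) \<otimes>\<^bsub>k\<^esub> inv\<^bsub>k\<^esub> ((x \<ominus>\<^bsub>k\<^esub> y) [^]\<^bsub>k\<^esub> (2::nat))))"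

text \<open>Indexing starts at \<open>1\<close>; the value at index \<open>0\<close> is a dummy.\<close>

fun PS_W :: "('a, 'b) ring_scheme \<Rightarrow> nat \<Rightarrow> ('a \<times> 'a) set" where
  "PS_W k 0 = {}"
| "PS_W k (Suc 0) = {(x, y) \<in> carrier k \<times> carrier k. x = y}"
| "PS_W k (Suc (Suc n)) =
     {z \<in> (carrier k \<times> carrier k) - (\<Union>i\<in>{1..Suc n}. PS_W k i).
        pappus_steiner k z \<in> PS_W k (Suc n)}"

definition PS_A :: "('a, 'b) ring_scheme \<Rightarrow> ('a \<times> 'a) set" where
  "PS_A k = (carrier k \<times> carrier k) - (\<Union>i\<in>{1..}. PS_W k i)"

definition PS_has_period :: "('a, 'b) ring_scheme \<Rightarrow> 'a \<times> 'a \<Rightarrow> nat \<Rightarrow> bool" where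
  "PS_has_period k z n \<longleftrightarrow>
     z \<in> PS_A k \<and> n > 0 \<and> (pappus_steiner k ^^ n) z = z \<and>
     (\<forall>m. 0 < m \<and> m < n \<longrightarrow> (pappus_steiner k ^^ m) z \<noteq> z)"

end

theory Submission
  imports Defs "HOL-Number_Theory.Quadratic_Reciprocity"
begin

text \<open>
  Along an orbit the quantity \<open>q = 4 (x - y) / y\<close> satisfies \<open>q\<^sub>n\<^sub>+\<^sub>2 = q\<^sub>n\<^sup>2 - 2 q\<^sub>n\<^sub>+\<^sub>1 - 4\<close>, and it
  determines the orbit. Decomposing a 4-cycle of this recurrence under the shift by two shows that
  one exists exactly if \<open>d\<^sup>2 = 5\<close> or \<open>d\<^sup>4 - 17 d\<^sup>2 + 68 = 0\<close> is solvable. The first equation is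
  governed by quadratic reciprocity. The roots of the second are the differences of opposite quartic
  Gaussian periods of the 17th roots of unity, which the Frobenius of \<open>p\<close> fixes if
  \<open>p \<equiv> 1, 4, 13, 16 (mod 17)\<close> and negates if \<open>p \<equiv> 2, 8, 9, 15\<close>; for the other classes 17 is not
  even a square modulo \<open>p\<close>.
\<close>

section \<open>The quartic Gaussian periods of conductor 17\<close>

definition cyclotomic17 :: "int poly" where
  "cyclotomic17 = [:1, 1, 1, 1, 1, 1, 1, 1, 1, 1, 1, 1, 1, 1, 1, 1, 1:]"

text \<open>Congruence modulo \<open>p\<close> in the ring of integers of the 17th cyclotomic field, written as
  \<open>\<int>[X]\<close> modulo the cyclotomic polynomial.\<close>

definition cyc_cong :: "int \<Rightarrow> int poly \<Rightarrow> int poly \<Rightarrow> bool" where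
  "cyc_cong p A B \<longleftrightarrow> (\<exists>u v. A - B = [:p:] * u + cyclotomic17 * v)"

lemma cyc_congI: "A - B = [:p:] * u + cyclotomic17 * v \<Longrightarrow> cyc_cong p A B"
  unfolding cyc_cong_def by blast

lemma cyc_congI_cyclotomic: "A - B = cyclotomic17 * v \<Longrightarrow> cyc_cong p A B"
  by (rule cyc_congI[of _ _ _ 0 v]) simp

lemma cyc_cong_refl [simp]: "cyc_cong p A A"
  by (rule cyc_congI[of _ _ _ 0 0]) simp

text \<open>Congruence means that the difference lies in the ideal generated by p and the cyclotomic
  polynomial, so an identity with explicit cofactors \<open>G\<close> and \<open>H\<close> transfers
  it. The closure rules below are instances.\<close>

lemma cyc_cong_lincomb:
  assumes "cyc_cong p A B" "cyc_cong p C D" "E - F = G * (A - B) + H * (C - D)"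
  shows "cyc_cong p E F"
proof -
  obtain u v u' v' where "A - B = [:p:] * u + cyclotomic17 * v" "C - D = [:p:] * u' + cyclotomic17 * v'"
    using assms unfolding cyc_cong_def by blast
  with assms(3) have "E - F = [:p:] * (G * u + H * u') + cyclotomic17 * (G * v + H * v')"
    by (simp only: algebra_simps)
  then show ?thesis by (rule cyc_congI)
qed

lemma cyc_cong_sym: "cyc_cong p A B \<Longrightarrow> cyc_cong p B A"
  by (rule cyc_cong_lincomb[of p A B A B _ _ "-1" 0]) auto

lemma cyc_cong_trans [trans]: "cyc_cong p A B \<Longrightarrow> cyc_cong p B C \<Longrightarrow> cyc_cong p A C"
  by (rule cyc_cong_lincomb[of p A B B C _ _ 1 1]) auto

lemma cyc_cong_add: "cyc_cong p A B \<Longrightarrow> cyc_cong p C D \<Longrightarrow> cyc_cong p (A + C) (B + D)"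
  by (rule cyc_cong_lincomb[of p A B C D _ _ 1 1]) (auto simp: algebra_simps)

lemma cyc_cong_diff: "cyc_cong p A B \<Longrightarrow> cyc_cong p C D \<Longrightarrow> cyc_cong p (A - C) (B - D)"
  by (rule cyc_cong_lincomb[of p A B C D _ _ 1 "-1"]) (auto simp: algebra_simps)

lemma cyc_cong_mult: "cyc_cong p A B \<Longrightarrow> cyc_cong p C D \<Longrightarrow> cyc_cong p (A * C) (B * D)"
  by (rule cyc_cong_lincomb[of p A B C D _ _ C B]) (auto simp: algebra_simps)

lemma cyc_cong_power: "cyc_cong p A B \<Longrightarrow> cyc_cong p (A ^ n) (B ^ n)"
  by (induction n) (auto intro: cyc_cong_mult)

lemma cyc_cong_dvd: "[:p:] dvd A - B \<Longrightarrow> cyc_cong p A B"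
  unfolding cyc_cong_def dvd_def by (metis add.right_neutral mult_zero_right)

lemma cyc_cong_const: "[a = b] (mod p) \<Longrightarrow> cyc_cong p [:a:] [:b:]"
  by (rule cyc_cong_dvd) (auto simp: cong_iff_dvd_diff elim!: dvdE intro: dvdI[of _ _ "[:_:]"])

lemma degree_cyclotomic17: "Polynomial.degree cyclotomic17 = 16"
  by (simp add: cyclotomic17_def)

text \<open>The divisor is monic, so the scaling factor of pseudo-division over the integers is
  1.\<close>

lemma cyclotomic17_division:
  "\<exists>q r. u = cyclotomic17 * q + r \<and> Polynomial.degree r < 16"
proof -
  obtain q r where qr: "pseudo_divmod u cyclotomic17 = (q, r)"
    by fastforce
  have "cyclotomic17 \<noteq> 0" "poly.coeff cyclotomic17 16 = 1"
    by (simp_all add: cyclotomic17_def eval_nat_numeral)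
  from pseudo_divmod[OF _ qr] have "u = cyclotomic17 * q + r" "r = 0 \<or> Polynomial.degree r < 16"
    by (simp_all only: degree_cyclotomic17 \<open>poly.coeff cyclotomic17 16 = 1\<close> power_one smult_1_left \<open>cyclotomic17 \<noteq> 0\<close> not_False_eq_True)
  then show ?thesis
    by (intro exI[of _ q] exI[of _ r]) auto
qed

text \<open>After \<open>u\<close> is reduced to a remainder \<open>r\<close>, the remaining
  multiple of the cyclotomic polynomial has degree below 16, hence is 0. This lets a congruence
  between constants be read off as divisibility in the integers.\<close>

lemma cyc_cong_const_dvd:
  assumes "cyc_cong p [:a:] 0"
  shows "p dvd a"
proof -
  obtain u v where uv: "[:a:] = [:p:] * u + cyclotomic17 * v"
    using assms by (auto simp: cyc_cong_def)
  obtain q r where qr: "u = cyclotomic17 * q + r" "Polynomial.degree r < 16"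
    using cyclotomic17_division by blast
  have eq: "[:a:] - [:p:] * r = cyclotomic17 * ([:p:] * q + v)"
    unfolding uv qr(1) by (simp only: algebra_simps)
  have "Polynomial.degree ([:a:] - [:p:] * r) < 16"
    using qr(2) by (intro degree_diff_less) (auto intro: le_less_trans[OF degree_smult_le])
  then have "Polynomial.degree (cyclotomic17 * ([:p:] * q + v)) < 16"
    by (simp only: eq)
  moreover have "cyclotomic17 \<noteq> 0"
    using degree_cyclotomic17 by auto
  ultimately have "[:p:] * q + v = 0"
    using degree_mult_eq[of cyclotomic17 "[:p:] * q + v"] degree_cyclotomic17 by fastforce
  with eq have "[:a:] = smult p r" by simp
  then have "a = p * poly.coeff r 0"
    by (metis coeff_pCons_0 coeff_smult)
  then show ?thesis by simp
qed

section \<open>Frobenius on integer polynomials\<close>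

lemma prime_dvd_power_add_diff:
  fixes A B :: "'a::comm_ring_1"
  assumes "Factorial_Ring.prime p"
  shows "of_nat p dvd (A + B) ^ p - (A ^ p + B ^ p)"
proof -
  have p: "p > 0" using assms prime_gt_0_nat by blast
  then obtain k where k: "p = Suc k" by (cases p) auto
  have "(A + B) ^ p = (\<Sum>i\<le>p. of_nat (p choose i) * A ^ i * B ^ (p - i))"
    by (rule binomial_ring)
  also have "{..p} = insert 0 (insert p {1..<p})" using p by auto
  also have "(\<Sum>i\<in>\<dots>. of_nat (p choose i) * A ^ i * B ^ (p - i)) =
      B ^ p + A ^ p + (\<Sum>i = 1..<p. of_nat (p choose i) * A ^ i * B ^ (p - i))"
    using p by (simp add: algebra_simps)
  finally have "(A + B) ^ p - (A ^ p + B ^ p) = (\<Sum>i = 1..<p. of_nat (p choose i) * A ^ i * B ^ (p - i))"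
    by simp
  also have "of_nat p dvd \<dots>"
  proof (intro dvd_sum dvd_mult2)
    fix i assume "i \<in> {1..<p}"
    then have "p dvd p choose i"
      using assms by (intro dvd_choose_prime) auto
    then show "(of_nat p :: 'a) dvd of_nat (p choose i)" by (metis dvdE dvd_triv_left of_nat_mult)
  qed
  finally show ?thesis .
qed

lemma fermat_theorem_int:
  assumes "Factorial_Ring.prime p"
  shows "[a ^ p = a] (mod int p)"
proof -
  define n where "n = nat (a mod int p)"
  have p: "p > 0" using assms prime_gt_0_nat by blast
  then have an: "[a = int n] (mod int p)"
    by (simp add: n_def cong_def)
  have "[n ^ p = n] (mod p)"
  proof (cases "p dvd n")
    case True
    with p show ?thesis
      by (metis cong_0_iff cong_sym cong_trans dvd_power dvd_trans)
  next
    case False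
    then have "[n * n ^ (p - 1) = n * 1] (mod p)"
      using fermat_theorem[OF assms] by (intro cong_mult) auto
    with p show ?thesis by (simp add: power_eq_if)
  qed
  then have "[int n ^ p = int n] (mod int p)"
    by (metis cong_int_iff of_nat_power)
  then show ?thesis
    using an by (meson cong_pow cong_sym cong_trans)
qed

text \<open>Peel off one coefficient at a time: the p-th power is additive modulo p, Fermat fixes
  the constant, and the induction hypothesis is multiplied by \<open>X ^ p\<close>.\<close>

lemma frobenius_int_poly:
  fixes A :: "int poly"
  assumes "Factorial_Ring.prime p"
  shows "[:int p:] dvd A ^ p - pcompose A ([:0, 1:] ^ p)"
proof (induction A)
  case 0
  then show ?case using prime_gt_0_nat[OF assms] by (simp add: power_0_left)
next
  case (pCons a A)
  have 1: "pCons a A = [:a:] + [:0, 1:] * A" by simp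
  have "of_nat p dvd ([:a:] + [:0, 1:] * A) ^ p - ([:a:] ^ p + ([:0, 1:] * A) ^ p)"
    by (rule prime_dvd_power_add_diff[OF assms])
  then have d1: "[:int p:] dvd (pCons a A) ^ p - ([:a:] ^ p + ([:0, 1:] * A) ^ p)"
    by (subst 1) (simp only: of_nat_poly)
  have "[a ^ p = a] (mod int p)"
    by (rule fermat_theorem_int[OF assms])
  then have d2: "[:int p:] dvd [:a:] ^ p - [:a:]"
    by (simp add: cong_iff_dvd_diff poly_const_pow)
  have d3: "[:int p:] dvd [:0, 1:] ^ p * (A ^ p - pcompose A ([:0, 1:] ^ p))"
    using pCons.IH by simp
  have "pCons a A ^ p - pcompose (pCons a A) ([:0, 1:] ^ p) =
     ((pCons a A) ^ p - ([:a:] ^ p + ([:0, 1:] * A) ^ p)) + ([:a:] ^ p - [:a:])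
      + [:0, 1:] ^ p * (A ^ p - pcompose A ([:0, 1:] ^ p))"
    by (simp only: pcompose_pCons power_mult_distrib algebra_simps)
  then show ?case using d1 d2 d3 by (metis dvd_add)
qed

text \<open>The difference of the Gaussian periods of the cosets \<open>{1, 4, 13, 16}\<close> and \<open>{2, 8, 9, 15}\<close>
  of the fourth powers modulo 17, with \<open>X\<close> in place of the root of unity.\<close>

definition period_diff :: "int poly" where
  "period_diff = [:0, 1, -1, 0, 1, 0, 0, 0, -1, -1, 0, 0, 0, 1, 0, -1, 1:]"

lemma period_diff_minpoly:
  "cyc_cong p (period_diff ^ 4 - 17 * period_diff\<^sup>2 + 68) 0"
proof -
  \<comment> \<open>The sum of the same two quartic periods, that is, the quadratic period over the
    nonzero squares modulo 17. It is a root of \<open>e^2 + e - 4\<close>; the factors on the right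
    below are quotients by the cyclotomic polynomial.\<close>
  define e :: "int poly" where "e = [:0, 1, 1, 0, 1, 0, 0, 0, 1, 1, 0, 0, 0, 1, 0, 1, 1:]"
  have "period_diff * period_diff + e - [:8:] - 0 = cyclotomic17 * [:-8,9,1,-4,4,0,-4,2,2,-3,1,2,-4,1,3,-3,1:]"
    by (simp add: period_diff_def e_def cyclotomic17_def)
  then have a: "cyc_cong p (period_diff * period_diff + e - [:8:]) 0"
    by (rule cyc_congI_cyclotomic)
  have "e * e + e - [:4:] - 0 = cyclotomic17 * [:-4,5,1,0,0,0,0,-2,2,1,1,-2,0,1,-1,1,1:]"
    by (simp add: e_def cyclotomic17_def)
  then have b: "cyc_cong p (e * e + e - [:4:]) 0"
    by (rule cyc_congI_cyclotomic)
  define d where "d = period_diff * period_diff"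
  have n: "[:8:] = (8 :: int poly)" "[:4:] = (4 :: int poly)"
    by (simp_all add: numeral_poly)
  \<comment> \<open>Eliminates \<open>e\<close> from \<open>d = 8 - e\<close> and
    \<open>e^2 + e - 4 = 0\<close>.\<close>
  have "d * d - 17 * d + 68 - 0 = (d - e - 9) * (d + e - 8 - 0) + 1 * (e * e + e - 4 - 0)"
    by (simp add: algebra_simps)
  from cyc_cong_lincomb[OF a[folded d_def, unfolded n] b[unfolded n] this]
  show ?thesis
    by (simp only: d_def power2_eq_square power4_eq_xxxx mult.assoc)
qed

section \<open>The action of Frobenius on the period difference\<close>

lemma cyc_cong_X_power:
  "[a = b] (mod 17) \<Longrightarrow> cyc_cong p ([:0, 1:] ^ a) ([:0, 1:] ^ b)"
proof -
  assume ab: "[a = b] (mod 17)"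
  have "[:0, 1:] ^ 17 - 1 = cyclotomic17 * [:-1, 1:]"
    by (simp add: cyclotomic17_def eval_nat_numeral one_pCons)
  then have 1: "cyc_cong p ([:0, 1:] ^ 17) 1"
    by (rule cyc_congI_cyclotomic)
  have 2: "cyc_cong p ([:0, 1:] ^ n) ([:0, 1:] ^ (n mod 17))" for n
  proof -
    have "[:0, 1 :: int:] ^ n = ([:0, 1:] ^ 17) ^ (n div 17) * [:0, 1:] ^ (n mod 17)"
      by (simp only: power_mult[symmetric] power_add[symmetric] mult_div_mod_eq)
    also have "cyc_cong p \<dots> (1 ^ (n div 17) * [:0, 1:] ^ (n mod 17))"
      by (intro cyc_cong_mult cyc_cong_power 1 cyc_cong_refl)
    finally show ?thesis by simp
  qed
  show ?thesis
    using 2[of a] 2[of b] ab cyc_cong_sym cyc_cong_trans unfolding cong_def by metis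
qed

lemma period_diff_eq:
  "period_diff = [:0, 1:] ^ 1 + [:0, 1:] ^ 4 + [:0, 1:] ^ 13 + [:0, 1:] ^ 16
     - ([:0, 1:] ^ 2 + [:0, 1:] ^ 8 + [:0, 1:] ^ 9 + [:0, 1:] ^ 15)"
  by (simp add: period_diff_def eval_nat_numeral)

lemma period_diff_power_prime:
  assumes "Factorial_Ring.prime p"
  shows "cyc_cong (int p) (period_diff ^ p)
    ([:0, 1:] ^ (1 * p) + [:0, 1:] ^ (4 * p) + [:0, 1:] ^ (13 * p) + [:0, 1:] ^ (16 * p)
     - ([:0, 1:] ^ (2 * p) + [:0, 1:] ^ (8 * p) + [:0, 1:] ^ (9 * p) + [:0, 1:] ^ (15 * p)))"
    (is "cyc_cong _ _ ?rhs")
proof -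
  have "pcompose ([:0, 1:] ^ n) ([:0, 1 :: int:] ^ p) = [:0, 1:] ^ (n * p)" for n
    by (induction n) (simp_all only: power_0 pcompose_1 mult_0 power_Suc pcompose_mult mult_Suc power_add, simp add: pcompose_pCons)
  then have "pcompose period_diff ([:0, 1:] ^ p) = ?rhs"
    unfolding period_diff_eq by (simp only: pcompose_add pcompose_diff)
  with cyc_cong_dvd[OF frobenius_int_poly[OF assms, of period_diff]] show ?thesis
    by simp
qed

text \<open>Frobenius multiplies exponents by p modulo 17. A multiplier in {1, 4, 13, 16} preserves
  this subgroup and its coset {2, 8, 9, 15}; a multiplier in the coset exchanges the two.\<close>

lemma period_diff_frobenius:
  assumes p: "Factorial_Ring.prime p"
  shows "p mod 17 \<in> {1, 4, 13, 16} \<Longrightarrow> cyc_cong (int p) (period_diff ^ p) period_diff"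
    and "p mod 17 \<in> {2, 8, 9, 15} \<Longrightarrow> cyc_cong (int p) (period_diff ^ p) (- period_diff)"
proof -
  have X: "cyc_cong (int p) ([:0, 1:] ^ (k * p)) ([:0, 1:] ^ b)" if "[k * (p mod 17) = b] (mod 17)" for k b
    using that by (intro cyc_cong_X_power) (simp add: cong_def mod_mult_right_eq)
  note conv = period_diff_power_prime[OF p, THEN cyc_cong_trans]
  {
    fix a b c d a' b' c' d'
    assume "[1 * (p mod 17) = a] (mod 17)" "[4 * (p mod 17) = b] (mod 17)"
      "[13 * (p mod 17) = c] (mod 17)" "[16 * (p mod 17) = d] (mod 17)"
      "[2 * (p mod 17) = a'] (mod 17)" "[8 * (p mod 17) = b'] (mod 17)"
      "[9 * (p mod 17) = c'] (mod 17)" "[15 * (p mod 17) = d'] (mod 17)"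
    then have "cyc_cong (int p) (period_diff ^ p) ([:0, 1:] ^ a + [:0, 1:] ^ b + [:0, 1:] ^ c + [:0, 1:] ^ d
       - ([:0, 1:] ^ a' + [:0, 1:] ^ b' + [:0, 1:] ^ c' + [:0, 1:] ^ d'))"
      by (intro conv cyc_cong_add cyc_cong_diff X)
  } note F = this
  show "cyc_cong (int p) (period_diff ^ p) period_diff" if "p mod 17 \<in> {1, 4, 13, 16}"
  proof -
    from that consider "p mod 17 = 1" | "p mod 17 = 4" | "p mod 17 = 13" | "p mod 17 = 16" by blast
    then show ?thesis
    proof cases
      \<comment> \<open>In each case the arguments of \<open>F\<close> are the exponents 1, 4, 13,
        16, 2, 8, 9, 15 multiplied by p modulo 17.\<close>
      case 1 then show ?thesis using F[of 1 4 13 16 2 8 9 15] unfolding period_diff_eq by (simp add: cong_def add_ac)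
    next
      case 2 then show ?thesis using F[of 4 16 1 13 8 15 2 9] unfolding period_diff_eq by (simp add: cong_def add_ac)
    next
      case 3 then show ?thesis using F[of 13 1 16 4 9 2 15 8] unfolding period_diff_eq by (simp add: cong_def add_ac)
    next
      case 4 then show ?thesis using F[of 16 13 4 1 15 9 8 2] unfolding period_diff_eq by (simp add: cong_def add_ac)
    qed
  qed
  show "cyc_cong (int p) (period_diff ^ p) (- period_diff)" if "p mod 17 \<in> {2, 8, 9, 15}"
  proof -
    from that consider "p mod 17 = 2" | "p mod 17 = 8" | "p mod 17 = 9" | "p mod 17 = 15" by blast
    then show ?thesis
    proof cases
      case 1 then show ?thesis using F[of 2 8 9 15 4 16 1 13] unfolding period_diff_eq by (simp add: cong_def add_ac)
    next
      case 2 then show ?thesis using F[of 8 15 2 9 16 13 4 1] unfolding period_diff_eq by (simp add: cong_def add_ac)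
    next
      case 3 then show ?thesis using F[of 9 2 15 8 1 4 13 16] unfolding period_diff_eq by (simp add: cong_def add_ac)
    next
      case 4 then show ?thesis using F[of 15 9 8 2 13 1 16 4] unfolding period_diff_eq by (simp add: cong_def add_ac)
    qed
  qed
qed

text \<open>Otherwise \<open>2 * period_diff\<close> vanishes, and twice the quartic relation leaves
  136 = 2^3 * 17, which no prime above 17 divides. Thus the two Frobenius actions are
  incompatible.\<close>

lemma period_diff_not_self_negative:
  assumes "Factorial_Ring.prime p" "p > 17"
  shows "\<not> cyc_cong (int p) period_diff (- period_diff)"
proof
  assume "cyc_cong (int p) period_diff (- period_diff)"
  then have "cyc_cong (int p) [:136:] 0"
    by (rule cyc_cong_lincomb[OF _ period_diff_minpoly, where G = "17 * period_diff - period_diff ^ 3" and H = 2])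
       (simp add: algebra_simps power2_eq_square power3_eq_cube power4_eq_xxxx numeral_poly)
  then have "int p dvd 136" by (rule cyc_cong_const_dvd)
  then have "p dvd 2 * 2 * 2 * 17" by presburger
  then have "p dvd 2 \<or> p dvd 17"
    using assms(1) prime_dvd_mult_nat by blast
  with assms(2) show False by (auto dest: dvd_imp_le)
qed

text \<open>Euler's criterion in the quadratic extension generated by \<open>period_diff\<^sup>2\<close>: the
  polynomial \<open>t ^ m - s\<close> with \<open>m = (p - 1) / 2\<close> vanishes at both roots \<open>w\<close> and \<open>w'\<close> of
  \<open>t\<^sup>2 - 17 t + 68\<close>, hence at every root in any \<open>F\<^sub>p\<close>-algebra.\<close>

lemma period_diff_power_root:
  fixes w :: int
  assumes p: "Factorial_Ring.prime p" "p > 17" and w: "int p dvd w\<^sup>2 - 17 * w + 68"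
    and m: "p = Suc (2 * m)"
  shows "cyc_cong (int p) (period_diff ^ p) ([:w ^ m:] * period_diff)"
proof -
  let ?d = "period_diff"
  define w' where "w' = 17 - w"
  have pi: "Factorial_Ring.prime (int p)" using p by simp
  have cop: "coprime (int p) x" if "\<not> int p dvd x" for x
    using that pi prime_imp_coprime by blast
  \<comment> \<open>17 is the discriminant of \<open>t^2 - 17 * t + 68\<close>; hence its roots are
    distinct modulo p.\<close>
  have disc: "int p dvd (w - w')\<^sup>2 - 17"
  proof -
    have "(w - w')\<^sup>2 - 17 = 4 * (w\<^sup>2 - 17 * w + 68)"
      by (simp add: w'_def algebra_simps power2_eq_square)
    then show ?thesis using w by (metis dvd_mult)
  qed
  have ndvd: "\<not> int p dvd w - w'"
  proof
    assume "int p dvd w - w'"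
    then have "int p dvd (w - w')\<^sup>2" by (simp add: power2_eq_square)
    with disc have "int p dvd 17" by (metis dvd_diff_right_iff)
    with p show False by (auto dest: zdvd_imp_le)
  qed
  \<comment> \<open>The product of the roots is 68 = 4 * 17, a nonzero square because 17 is the
    square of \<open>w - w'\<close>. So \<open>w\<close> and \<open>w'\<close> have the same
    quadratic character, which gives \<open>same\<close> below.\<close>
  have "[w * w' = (2 * (w - w'))\<^sup>2] (mod int p)"
  proof -
    have "w * w' - (2 * (w - w'))\<^sup>2 = - 17 * (w\<^sup>2 - 17 * w + 68)"
      by (simp add: w'_def algebra_simps power2_eq_square)
    then show ?thesis using w by (metis cong_iff_dvd_diff dvd_mult)
  qed
  then have "[(w * w') ^ m = ((2 * (w - w'))\<^sup>2) ^ m] (mod int p)"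
    by (rule cong_pow)
  moreover have "[((2 * (w - w'))\<^sup>2) ^ m = 1] (mod int p)"
  proof -
    have "\<not> int p dvd 2 * (w - w')"
    proof
      assume "int p dvd 2 * (w - w')"
      with ndvd have "int p dvd 2" using prime_dvd_multD[OF pi] by blast
      with p show False by (auto dest: zdvd_imp_le)
    qed
    then have c: "coprime (2 * (w - w')) (int p)"
      using cop coprime_commute by blast
    have "[(2 * (w - w')) ^ Suc (2 * m) = 2 * (w - w')] (mod int p)"
      using fermat_theorem_int[OF p(1)] m by simp
    then have "[2 * (w - w') * (2 * (w - w')) ^ (2 * m) = 2 * (w - w') * 1] (mod int p)"
      by simp
    then show ?thesis
      using c by (metis cong_mult_lcancel power_mult)
  qed
  ultimately have ww': "[w ^ m * w' ^ m = 1] (mod int p)"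
    by (metis cong_trans power_mult_distrib)
  have "\<not> int p dvd w"
  proof
    assume "int p dvd w"
    then have "int p dvd w * (w - 17)" by simp
    moreover have "68 = (w\<^sup>2 - 17 * w + 68) - w * (w - 17)"
      by (simp add: algebra_simps power2_eq_square)
    ultimately have "int p dvd 68" using w by (metis dvd_diff)
    then have "p dvd 2 * 2 * 17" by presburger
    then have "p dvd 2 \<or> p dvd 17"
      using p(1) prime_dvd_mult_nat by blast
    with p show False by (auto dest: dvd_imp_le)
  qed
  then have cw: "coprime w (int p)" using cop coprime_commute by blast
  have "[w * (w ^ m) ^ 2 = w * 1] (mod int p)"
    using fermat_theorem_int[OF p(1), of w] m by (simp add: power_mult[symmetric] mult.commute)
  then have sq: "[(w ^ m)\<^sup>2 = 1] (mod int p)"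
    using cw cong_mult_lcancel by blast
  have same: "[w' ^ m = w ^ m] (mod int p)"
  proof -
    have "[w' ^ m = (w ^ m)\<^sup>2 * w' ^ m] (mod int p)"
      using cong_scalar_right[OF sq, of "w' ^ m"] by (simp add: cong_sym)
    also have "(w ^ m)\<^sup>2 * w' ^ m = w ^ m * (w ^ m * w' ^ m)"
      by (simp add: power2_eq_square)
    also have "[\<dots> = w ^ m * 1] (mod int p)"
      using ww' by (rule cong_scalar_left)
    finally show ?thesis by simp
  qed
  have quad: "cyc_cong (int p) ((?d\<^sup>2 - [:w:]) * (?d\<^sup>2 - [:w':])) 0"
  proof -
    have "cyc_cong (int p) [:w\<^sup>2 - 17 * w + 68:] 0"
      using cyc_cong_const[of "w\<^sup>2 - 17 * w + 68" 0 "int p"] w by (simp add: cong_0_iff)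
    note c = this
    have c1: "[:w':] = 17 - [:w:]" and c2: "[:w\<^sup>2 - 17 * w + 68:] = [:w:]\<^sup>2 - 17 * [:w:] + 68"
      by (simp_all add: w'_def numeral_poly power2_eq_square)
    have "(d\<^sup>2 - x) * (d\<^sup>2 - (17 - x)) - 0 =
        1 * (d ^ 4 - 17 * d\<^sup>2 + 68 - 0) + (- 1) * (x\<^sup>2 - 17 * x + 68 - 0)" for d x :: "int poly"
      by (simp add: algebra_simps power2_eq_square power4_eq_xxxx)
    from cyc_cong_lincomb[OF period_diff_minpoly c[unfolded c2] this] show ?thesis
      unfolding c1 .
  qed
  define s where "s = w ^ m"
  obtain A where A: "(?d\<^sup>2) ^ m - [:w:] ^ m = (?d\<^sup>2 - [:w:]) * A"
    by (metis power_diff_sumr2)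
  obtain A' where A': "(?d\<^sup>2) ^ m - [:w':] ^ m = (?d\<^sup>2 - [:w':]) * A'"
    by (metis power_diff_sumr2)
  have t: "cyc_cong (int p) ((?d\<^sup>2) ^ m - [:s:]) ((?d\<^sup>2 - [:w:]) * A)"
    using A by (simp add: s_def poly_const_pow)
  have t': "cyc_cong (int p) ((?d\<^sup>2) ^ m - [:s:]) ((?d\<^sup>2 - [:w':]) * A')"
  proof -
    have "cyc_cong (int p) ((?d\<^sup>2) ^ m - [:s:]) ((?d\<^sup>2) ^ m - [:w' ^ m:])"
      unfolding s_def using same by (intro cyc_cong_diff cyc_cong_refl cyc_cong_const) (rule cong_sym)
    then show ?thesis using A' by (simp add: poly_const_pow)
  qed
  \<comment> \<open>Interpolation: \<open>t^m - s\<close> is divisible by \<open>t - w\<close> and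
    by \<open>t - w'\<close>. Multiplying by the other factor each time and subtracting leaves
    \<open>w - w'\<close> as coefficient, which is invertible.\<close>
  have "cyc_cong (int p) ([:w - w':] * ((?d\<^sup>2) ^ m - [:s:])) 0"
  proof -
    let ?t = "(?d\<^sup>2) ^ m - [:s:]"
    have "cyc_cong (int p) ((?d\<^sup>2 - [:w':]) * ?t) ((?d\<^sup>2 - [:w':]) * ((?d\<^sup>2 - [:w:]) * A))"
      by (intro cyc_cong_mult t cyc_cong_refl)
    moreover have "cyc_cong (int p) ((?d\<^sup>2 - [:w:]) * ?t) ((?d\<^sup>2 - [:w:]) * ((?d\<^sup>2 - [:w':]) * A'))"
      by (intro cyc_cong_mult t' cyc_cong_refl)
    ultimately have "cyc_cong (int p) ((?d\<^sup>2 - [:w':]) * ?t - (?d\<^sup>2 - [:w:]) * ?t)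
       ((?d\<^sup>2 - [:w':]) * ((?d\<^sup>2 - [:w:]) * A) - (?d\<^sup>2 - [:w:]) * ((?d\<^sup>2 - [:w':]) * A'))"
      by (rule cyc_cong_diff)
    also have "(?d\<^sup>2 - [:w':]) * ((?d\<^sup>2 - [:w:]) * A) - (?d\<^sup>2 - [:w:]) * ((?d\<^sup>2 - [:w':]) * A')
       = (?d\<^sup>2 - [:w:]) * (?d\<^sup>2 - [:w':]) * (A - A')"
      by (simp only: algebra_simps)
    also have "cyc_cong (int p) \<dots> (0 * (A - A'))"
      by (intro cyc_cong_mult quad cyc_cong_refl)
    finally have "cyc_cong (int p) ((?d\<^sup>2 - [:w':]) * ?t - (?d\<^sup>2 - [:w:]) * ?t) 0" by simp
    moreover have "(?d\<^sup>2 - [:w':]) * ?t - (?d\<^sup>2 - [:w:]) * ?t = ([:w:] - [:w':]) * ?t"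
      by (simp only: algebra_simps)
    ultimately show ?thesis by simp
  qed
  moreover obtain i where i: "[(w - w') * i = 1] (mod int p)"
    using cop[OF ndvd] cong_solve_coprime_int coprime_commute by metis
  ultimately have "cyc_cong (int p) ([:i:] * ([:w - w':] * ((?d\<^sup>2) ^ m - [:s:]))) ([:i:] * 0)"
    by (intro cyc_cong_mult cyc_cong_refl)
  also have "[:i:] * ([:w - w':] * ((?d\<^sup>2) ^ m - [:s:])) = [:(w - w') * i:] * ((?d\<^sup>2) ^ m - [:s:])"
    by (simp only: mult.assoc[symmetric]) (simp add: mult.commute)
  finally have "cyc_cong (int p) ([:(w - w') * i:] * ((?d\<^sup>2) ^ m - [:s:])) 0"
    by simp
  moreover have "cyc_cong (int p) ([:1:] * ((?d\<^sup>2) ^ m - [:s:])) ([:(w - w') * i:] * ((?d\<^sup>2) ^ m - [:s:]))"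
    using i by (intro cyc_cong_mult cyc_cong_const cyc_cong_refl) (rule cong_sym)
  ultimately have "cyc_cong (int p) ([:1:] * ((?d\<^sup>2) ^ m - [:s:])) 0"
    using cyc_cong_trans by blast
  then have "cyc_cong (int p) ((?d\<^sup>2) ^ m - [:s:]) 0"
    by (simp add: one_pCons)
  \<comment> \<open>One further factor \<open>period_diff\<close> turns the exponent
    \<open>2 * m\<close> into p.\<close>
  from cyc_cong_lincomb[OF this cyc_cong_refl, of "?d ^ p" "[:s:] * ?d" ?d 0]
  show ?thesis
    unfolding s_def by (simp add: m power_mult[symmetric] algebra_simps)
qed

section \<open>Square classes modulo 5 and 17, and the quartic modulo p\<close>

lemma QuadRes_mod_iff:
  assumes "m > 0"
  shows "QuadRes (int m) (int a) \<longleftrightarrow> (\<exists>y<m. y\<^sup>2 mod m = a mod m)"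
proof
  assume "QuadRes (int m) (int a)"
  then obtain y where y: "[y\<^sup>2 = int a] (mod int m)" by (auto simp: QuadRes_def)
  define n where "n = nat (y mod int m)"
  have n: "int n = y mod int m" "n < m"
    using assms by (auto simp: n_def nat_less_iff)
  have "[int (n\<^sup>2) = int a] (mod int m)"
    using y n by (simp add: cong_def power_mod)
  with n show "\<exists>y<m. y\<^sup>2 mod m = a mod m"
    by (metis cong_def cong_int_iff)
next
  assume "\<exists>y<m. y\<^sup>2 mod m = a mod m"
  then obtain y where "[y\<^sup>2 = a] (mod m)" by (auto simp: cong_def)
  then have "[(int y)\<^sup>2 = int a] (mod int m)" by (metis cong_int_iff of_nat_power)
  then show "QuadRes (int m) (int a)" unfolding QuadRes_def by blast
qed

lemma QuadRes_prime_reciprocal: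
  assumes "Factorial_Ring.prime p" "Factorial_Ring.prime q" "p > q" "q mod 4 = 1"
  shows "QuadRes (int p) (int q) \<longleftrightarrow> QuadRes (int q) (int p)"
proof -
  have q: "2 < q" using assms(2,4) prime_gt_1_nat[of q] by (cases "q = 2") auto
  have "even ((q - 1) div 2)" using assms(4) by presburger
  then have "Legendre (int p) (int q) * Legendre (int q) (int p) = 1"
    using Quadratic_Reciprocity[of p q] assms q by auto
  moreover have "\<not> [int q = 0] (mod int p)" "\<not> [int p = 0] (mod int q)"
    using assms q primes_dvd_imp_eq[of q p] primes_dvd_imp_eq[of p q] by (auto simp: cong_0_iff)
  ultimately show ?thesis
    unfolding Legendre_def by (auto split: if_splits)
qed

lemma squares_mod_17: "(\<exists>y<17. y\<^sup>2 mod 17 = (r::nat)) \<longleftrightarrow> r \<in> {0, 1, 4, 13, 16, 2, 8, 9, 15}"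
  unfolding Bex_def[of "{..<17}", unfolded lessThan_iff, symmetric]
  by (simp add: lessThan_nat_numeral) blast

lemma squares_mod_5: "(\<exists>y<5. y\<^sup>2 mod 5 = (r::nat)) \<longleftrightarrow> r \<in> {0, 1, 4}"
  unfolding Bex_def[of "{..<5}", unfolded lessThan_iff, symmetric]
  by (simp add: lessThan_nat_numeral) blast
lemma QuadRes_17:
  assumes "Factorial_Ring.prime p" "p > 17"
  shows "QuadRes (int p) 17 \<longleftrightarrow> p mod 17 \<in> {1, 4, 13, 16} \<union> {2, 8, 9, 15}"
proof -
  have "\<not> 17 dvd p"
    using assms primes_dvd_imp_eq[of 17 p] by auto
  then have "p mod 17 \<noteq> 0" by presburger
  moreover have "Factorial_Ring.prime (17 :: nat)" by simp
  ultimately show ?thesis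
    using QuadRes_prime_reciprocal[of p 17] QuadRes_mod_iff[of 17 p] squares_mod_17[of "p mod 17"] assms
    by simp blast
qed

lemma QuadRes_5:
  assumes "Factorial_Ring.prime p" "p > 5"
  shows "QuadRes (int p) 5 \<longleftrightarrow> p mod 5 \<in> {1, 4}"
proof -
  have "\<not> 5 dvd p"
    using assms primes_dvd_imp_eq[of 5 p] by auto
  then have "p mod 5 \<noteq> 0" by presburger
  moreover have "Factorial_Ring.prime (5 :: nat)" by simp
  ultimately show ?thesis
    using QuadRes_prime_reciprocal[of p 5] QuadRes_mod_iff[of 5 p] squares_mod_5[of "p mod 5"] assms
    by simp
qed

text \<open>A root makes 17 a square, which leaves eight classes modulo 17. For a root w of
  \<open>t^2 - 17 * t + 68\<close>, the p-th power of \<open>period_diff\<close> is the Legendre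
  symbol of w times \<open>period_diff\<close>; comparison with the Frobenius action decides whether
  w is a square.\<close>

lemma quartic_root_mod_prime_iff:
  assumes p: "Factorial_Ring.prime p" "p > 17"
  shows "(\<exists>c. int p dvd c ^ 4 - 17 * c\<^sup>2 + 68) \<longleftrightarrow> p mod 17 \<in> {1, 4, 13, 16}"
proof -
  have "odd p" using p prime_odd_nat by auto
  then obtain m where m: "p = Suc (2 * m)" by (metis oddE Suc_eq_plus1)
  have euler: "[Legendre w (int p) = w ^ m] (mod int p)" for w
    using euler_criterion[of p w] p m by simp
  have frob: "cyc_cong (int p) (period_diff ^ p) ([:Legendre w (int p):] * period_diff)"
    if "int p dvd w\<^sup>2 - 17 * w + 68" for w
    using period_diff_power_root[OF p that m] cyc_cong_mult[OF cyc_cong_const[OF euler] cyc_cong_refl]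
      cyc_cong_sym cyc_cong_trans by blast
  show ?thesis
  proof
    assume "\<exists>c. int p dvd c ^ 4 - 17 * c\<^sup>2 + 68"
    then obtain c where c: "int p dvd c ^ 4 - 17 * c\<^sup>2 + 68" by blast
    have "(2 * c\<^sup>2 - 17)\<^sup>2 - 17 = 4 * (c ^ 4 - 17 * c\<^sup>2 + 68)"
      by (simp add: algebra_simps power2_eq_square power4_eq_xxxx)
    then have "[(2 * c\<^sup>2 - 17)\<^sup>2 = 17] (mod int p)"
      using c by (metis cong_iff_dvd_diff dvd_mult)
    then have "QuadRes (int p) 17" unfolding QuadRes_def by blast
    then have r: "p mod 17 \<in> {1, 4, 13, 16} \<or> p mod 17 \<in> {2, 8, 9, 15}"
      using QuadRes_17[OF p] by blast
    have root: "int p dvd (c\<^sup>2)\<^sup>2 - 17 * c\<^sup>2 + 68"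
      using c by simp
    have "\<not> int p dvd c\<^sup>2"
    proof
      assume "int p dvd c\<^sup>2"
      then have "int p dvd c\<^sup>2 * (c\<^sup>2 - 17)" by simp
      moreover have "68 = ((c\<^sup>2)\<^sup>2 - 17 * c\<^sup>2 + 68) - c\<^sup>2 * (c\<^sup>2 - 17)"
        by (simp add: algebra_simps power2_eq_square)
      ultimately have "int p dvd 68" using root by (metis dvd_diff)
      then have "p dvd 2 * 2 * 17" by presburger
      then have "p dvd 2 \<or> p dvd 17"
        using p(1) prime_dvd_mult_nat by blast
      with p show False by (auto dest: dvd_imp_le)
    qed
    then have "Legendre (c\<^sup>2) (int p) = 1"
      unfolding Legendre_def QuadRes_def cong_0_iff using cong_refl by (metis (full_types))
    then have plus: "cyc_cong (int p) (period_diff ^ p) period_diff"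
      using frob[OF root] by simp
    show "p mod 17 \<in> {1, 4, 13, 16}"
      using r period_diff_frobenius(2)[OF p(1)] plus period_diff_not_self_negative[OF p]
        cyc_cong_sym cyc_cong_trans by blast
  next
    assume r: "p mod 17 \<in> {1, 4, 13, 16}"
    then obtain y where y: "[y\<^sup>2 = 17] (mod int p)"
      using QuadRes_17[OF p] by (auto simp: QuadRes_def)
    \<comment> \<open>The quadratic formula: \<open>m + 1\<close> is the inverse of 2 modulo
      \<open>p = 2 * m + 1\<close>.\<close>
    define w where "w = (17 + y) * (int m + 1)"
    have "int p = 2 * int m + 1" using m by simp
    then have "2 * w - 17 = y + int p * (17 + y)"
      by (simp add: w_def algebra_simps)
    then have "[2 * w - 17 = y] (mod int p)"
      by (simp add: cong_iff_dvd_diff)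
    then have "[(2 * w - 17)\<^sup>2 = 17] (mod int p)"
      using y cong_pow cong_trans by blast
    moreover have "(2 * w - 17)\<^sup>2 - 17 = 4 * (w\<^sup>2 - 17 * w + 68)"
      by (simp add: algebra_simps power2_eq_square)
    ultimately have "int p dvd 4 * (w\<^sup>2 - 17 * w + 68)"
      by (simp only: cong_iff_dvd_diff)
    moreover have "coprime (int p) 4"
    proof -
      have "coprime (int p) (2 ^ 2)" using \<open>odd p\<close> by (simp only: coprime_power_right_iff) simp
      then show ?thesis by simp
    qed
    ultimately have root: "int p dvd w\<^sup>2 - 17 * w + 68"
      by (simp only: coprime_dvd_mult_right_iff)
    have "Legendre w (int p) \<noteq> -1"
    proof
      assume "Legendre w (int p) = -1"
      then have "cyc_cong (int p) (period_diff ^ p) (- period_diff)"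
        using frob[OF root] by simp
      then show False
        using period_diff_frobenius(1)[OF p(1) r] period_diff_not_self_negative[OF p]
          cyc_cong_sym cyc_cong_trans by blast
    qed
    \<comment> \<open>The symbol is 1 or 0; in the latter case \<open>c = 0\<close> serves.\<close>
    then obtain c where c: "[c\<^sup>2 = w] (mod int p)"
      unfolding Legendre_def QuadRes_def
      by (metis cong_sym power_zero_numeral)
    have "[(c\<^sup>2)\<^sup>2 - 17 * c\<^sup>2 + 68 = w\<^sup>2 - 17 * w + 68] (mod int p)"
      by (intro cong_add cong_diff cong_mult cong_pow c cong_refl)
    then have "int p dvd (c\<^sup>2)\<^sup>2 - 17 * c\<^sup>2 + 68"
      using root cong_dvd_iff by blast
    then show "\<exists>c. int p dvd c ^ 4 - 17 * c\<^sup>2 + 68" by auto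
  qed
qed

section \<open>Points of period 4 over a field\<close>

definition off_diagonal :: "'a \<times> 'a \<Rightarrow> bool" where
  "off_diagonal z \<longleftrightarrow> fst z \<noteq> snd z"

text \<open>An orbit that meets the diagonal has a first such time; this turns unions of the sets
  \<open>PS_W\<close> into conditions on all iterates.\<close>

lemma all_iff_no_first_failure:
  "(\<forall>i::nat. P i) \<longleftrightarrow> (\<nexists>i. \<not> P i \<and> (\<forall>j<i. P j))"
  using exists_least_iff[of "\<lambda>i. \<not> P i"] by blast

lemma all_le_iff_no_first_failure:
  "(\<forall>i\<le>m::nat. P i) \<longleftrightarrow> (\<nexists>i. i \<le> m \<and> \<not> P i \<and> (\<forall>j<i. P j))"
  using exists_least_iff[of "\<lambda>i. \<not> P i"] by (meson le_trans linorder_not_le)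

lemma (in Ring.field) pappus_steiner_closed:
  assumes "z \<in> carrier R \<times> carrier R" "off_diagonal z"
  shows "pappus_steiner R z \<in> carrier R \<times> carrier R"
proof -
  obtain x y where z: "z = (x, y)" "x \<in> carrier R" "y \<in> carrier R" "x \<noteq> y"
    using assms by (cases z) (auto simp: off_diagonal_def)
  then have "(x \<ominus> y) [^] (2::nat) \<noteq> \<zero>"
    using r_right_minus_eq[of x y] by (simp add: numeral_2_eq_2 integral_iff)
  then have "inv ((x \<ominus> y) [^] (2::nat)) \<in> carrier R"
    using z by (simp add: field_Units)
  with z show ?thesis by (simp add: pappus_steiner_def)
qed

text \<open>Strong induction, since each level removes all earlier ones: by hypothesis the removals
  say that the preceding iterates are off the diagonal. The index is shifted because level 1 is the
  diagonal itself, met after 0 steps.\<close>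

lemma (in Ring.field) PS_W_iff:
  "z \<in> PS_W R (Suc n) \<longleftrightarrow> z \<in> carrier R \<times> carrier R \<and>
     \<not> off_diagonal ((pappus_steiner R ^^ n) z) \<and> (\<forall>i<n. off_diagonal ((pappus_steiner R ^^ i) z))"
proof (induction n arbitrary: z rule: less_induct)
  case (less n)
  show ?case
  proof (cases n)
    case 0
    then show ?thesis by (auto simp: off_diagonal_def)
  next
    case (Suc m)
    let ?f = "pappus_steiner R"
    have "(\<Union>i\<in>{1..Suc m}. PS_W R i) = (\<Union>i\<in>{..m}. PS_W R (Suc i))"
      by (metis UN_simps(10) One_nat_def image_Suc_atMost)
    moreover have "z \<in> PS_W R (Suc i) \<longleftrightarrow> z \<in> carrier R \<times> carrier R \<and>
       \<not> off_diagonal ((?f ^^ i) z) \<and> (\<forall>j<i. off_diagonal ((?f ^^ j) z))" if "i \<le> m" for i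
      using less.IH[of i z] that Suc by simp
    ultimately have U: "z \<notin> (\<Union>i\<in>{1..Suc m}. PS_W R i) \<longleftrightarrow> (\<forall>i\<le>m. off_diagonal ((?f ^^ i) z))"
      if "z \<in> carrier R \<times> carrier R"
      using that all_le_iff_no_first_failure[of m "\<lambda>n. off_diagonal ((?f ^^ n) z)"]
      by (simp add: Ball_def)
    have f: "?f z \<in> PS_W R (Suc m) \<longleftrightarrow> ?f z \<in> carrier R \<times> carrier R \<and>
       \<not> off_diagonal ((?f ^^ Suc m) z) \<and> (\<forall>i<m. off_diagonal ((?f ^^ Suc i) z))"
      using less.IH[of m "?f z"] Suc by (simp add: funpow_swap1)
    have "z \<in> PS_W R (Suc n) \<longleftrightarrow> z \<in> carrier R \<times> carrier R \<and>
       (\<forall>i\<le>m. off_diagonal ((?f ^^ i) z)) \<and> ?f z \<in> PS_W R (Suc m)"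
      using U unfolding Suc PS_W.simps(3) by blast
    also have "\<dots> \<longleftrightarrow> z \<in> carrier R \<times> carrier R \<and>
       \<not> off_diagonal ((?f ^^ Suc m) z) \<and> (\<forall>i<Suc m. off_diagonal ((?f ^^ i) z))"
    proof -
      have "(\<forall>i<Suc m. off_diagonal ((?f ^^ i) z)) \<longleftrightarrow>
          off_diagonal z \<and> (\<forall>i<m. off_diagonal ((?f ^^ Suc i) z))"
        unfolding All_less_Suc2 by simp
      then show ?thesis
        unfolding f less_Suc_eq_le[symmetric] using pappus_steiner_closed[of z] by blast
    qed
    finally show ?thesis by (simp only: Suc)
  qed
qed

lemma (in Ring.field) PS_A_iff:
  "z \<in> PS_A R \<longleftrightarrow> z \<in> carrier R \<times> carrier R \<and> (\<forall>n. off_diagonal ((pappus_steiner R ^^ n) z))"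
proof -
  have "(\<Union>i\<in>{1..}. PS_W R i) = (\<Union>i. PS_W R (Suc i))"
    by (auto simp: Suc_le_eq gr0_conv_Suc)
  then show ?thesis
    unfolding PS_A_def using all_iff_no_first_failure[of "\<lambda>n. off_diagonal ((pappus_steiner R ^^ n) z)"]
    by (simp add: PS_W_iff) blast
qed

text \<open>Identities in the field \<open>R\<close>, which is a record, are obtained from polynomial identities in the
  type \<open>'b\<close>, where the simplifier can normalise. The intended maps are the identity of \<open>rat\<close> and
  reduction \<open>int \<Rightarrow> F\<^sub>p\<close>.\<close>

locale field_image = Ring.field R for R :: "('a, 'c) ring_scheme" (structure) +
  fixes h :: "'b::comm_ring_1 \<Rightarrow> 'a"
  assumes h_range: "range h = carrier R"
    and h_add: "h (a + b) = h a \<oplus> h b"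
    and h_mult: "h (a * b) = h a \<otimes> h b"
    and h_1: "h 1 = \<one>"
begin

lemma h_closed [simp]: "h a \<in> carrier R"
  using h_range by blast

lemma h_0: "h 0 = \<zero>"
  using h_add[of 0 0] by (metis h_closed add.l_cancel_one add_0)

lemma h_minus: "h (- a) = \<ominus> h a"
  using h_add[of a "- a"] h_0 by (metis h_closed right_minus minus_equality a_comm)

lemma h_diff: "h (a - b) = h a \<ominus> h b"
  using h_add[of a "- b"] by (simp add: h_minus minus_eq)

lemma h_power: "h (a ^ n) = h a [^] (n :: nat)"
  by (induction n) (simp_all add: h_1 h_mult m_comm)

lemma h_eq_iff: "h a = h b \<longleftrightarrow> h (a - b) = \<zero>"
  by (simp add: h_diff)

lemma h_mult_eq_0_iff: "h (a * b) = \<zero> \<longleftrightarrow> h a = \<zero> \<or> h b = \<zero>"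
  by (simp add: h_mult integral_iff)

lemma h_lincomb:
  assumes "h a = \<zero>" "h b = \<zero>" "c = x * a + y * b"
  shows "h c = \<zero>"
  using assms by (simp add: h_add h_mult)

lemma h_lincomb3:
  assumes "h a = \<zero>" "h b = \<zero>" "h c = \<zero>" "d = x * a + y * b + z * c"
  shows "h d = \<zero>"
  using assms by (simp add: h_add h_mult)

lemma h_inverse:
  assumes "h a \<noteq> \<zero>"
  shows "\<exists>b. h (a * b - 1) = \<zero>"
proof -
  have "inv (h a) \<in> carrier R" and inv: "h a \<otimes> inv (h a) = \<one>"
    using assms field_Units by auto
  then obtain b where "h b = inv (h a)" using h_range by (metis imageE)
  with inv have "h (a * b) = h 1" by (simp add: h_mult h_1)
  then show ?thesis using h_eq_iff by blast
qed

section \<open>From a point of period 4 to a 4-cycle of the recurrence\<close>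

lemma pappus_steiner_eq_iff:
  assumes "h a \<noteq> h b"
  shows "pappus_steiner R (h a, h b) = (h a', h b') \<longleftrightarrow>
    h (2 * b * (b - a + 2) - a' * (a - b)\<^sup>2) = \<zero> \<and> h (b\<^sup>2 - b' * (a - b)\<^sup>2) = \<zero>"
proof -
  have nz: "h ((a - b)\<^sup>2) \<noteq> \<zero>"
    using assms by (simp add: power2_eq_square h_mult_eq_0_iff h_eq_iff)
  have div: "h x \<otimes> inv (h ((a - b)\<^sup>2)) = h y \<longleftrightarrow> h (x - y * (a - b)\<^sup>2) = \<zero>" for x y
  proof -
    have "h ((a - b)\<^sup>2) \<in> Units R" using nz by (simp add: field_Units)
    then have "h x \<otimes> inv (h ((a - b)\<^sup>2)) = h y \<longleftrightarrow> h x = h y \<otimes> h ((a - b)\<^sup>2)"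
      by (metis Units_closed Units_inv_closed Units_l_inv Units_r_inv h_closed m_assoc r_one)
    then show ?thesis by (simp add: h_mult[symmetric] h_eq_iff)
  qed
  have two: "\<one> \<oplus> \<one> = h 2"
    by (metis h_1 h_add one_add_one)
  have "pappus_steiner R (h a, h b) =
      (h (2 * b * (b - a + 2)) \<otimes> inv (h ((a - b)\<^sup>2)), h (b\<^sup>2) \<otimes> inv (h ((a - b)\<^sup>2)))"
    by (simp add: pappus_steiner_def two h_mult h_add h_diff h_power)
  then show ?thesis by (simp add: div)
qed

lemma h_cancel_power_2:
  assumes "h 2 \<noteq> \<zero>" "h (2 ^ n * a) = \<zero>"
  shows "h a = \<zero>"
  using assms(2) by (induction n) (simp_all add: assms(1) h_mult_eq_0_iff mult.assoc)

text \<open>Here \<open>w\<close> and \<open>w'\<close> stand for 1/y and 1/y'. With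
  \<open>q = 4 * (x - y) * w\<close> the conclusions read \<open>16 * w' = q^2\<close> and
  \<open>q' + 2 * q + 4 = 16 * w\<close>; two consecutive steps together give the
  recurrence.\<close>

lemma pappus_steiner_step:
  assumes "h (y * w - 1) = \<zero>" "h (y' * w' - 1) = \<zero>" "h x \<noteq> h y"
    and "pappus_steiner R (h x, h y) = (h x', h y')"
  shows "h (w' - (x - y)\<^sup>2 * w\<^sup>2) = \<zero>"
    and "h (4 * (x' - y') * w' + 2 * (4 * (x - y) * w) + 4 - 16 * w) = \<zero>"
proof -
  have e3: "h (2 * y * (y - x + 2) - x' * (x - y)\<^sup>2) = \<zero>" and e4: "h (y\<^sup>2 - y' * (x - y)\<^sup>2) = \<zero>"
    using assms pappus_steiner_eq_iff by blast+
  show A: "h (w' - (x - y)\<^sup>2 * w\<^sup>2) = \<zero>"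
    by (rule h_lincomb3[OF e4 assms(1,2), where x = "w\<^sup>2 * w'" and y = "- w' * (y * w + 1)" and z = "(x - y)\<^sup>2 * w\<^sup>2"])
       (simp add: algebra_simps power2_eq_square)
  have B: "h (4 * (x' - y') * (w' - (x - y)\<^sup>2 * w\<^sup>2)
        + (- 4 * w\<^sup>2) * (2 * y * (y - x + 2) - x' * (x - y)\<^sup>2) + 4 * w\<^sup>2 * (y\<^sup>2 - y' * (x - y)\<^sup>2)) = \<zero>"
    by (rule h_lincomb3[OF A e3 e4 refl])
  show "h (4 * (x' - y') * w' + 2 * (4 * (x - y) * w) + 4 - 16 * w) = \<zero>"
    by (rule h_lincomb[OF B assms(1), where x = 1 and y = "16 * w - 8 * (x - y) * w - 4 * (y * w + 1)"])
       (simp add: algebra_simps power2_eq_square)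
qed

text \<open>The substitution \<open>q = 4 (x - y) / y\<close> turns the orbit into the recurrence
  \<open>q\<^sub>n\<^sub>+\<^sub>2 = q\<^sub>n\<^sup>2 - 2 q\<^sub>n\<^sub>+\<^sub>1 - 4\<close>.\<close>

lemma period4_imp_cycle:
  assumes h2: "h 2 \<noteq> \<zero>" and per: "PS_has_period R z 4"
  obtains q0 q1 q2 q3 where
    "h (q2 + 2 * q1 + 4 - q0\<^sup>2) = \<zero>" "h (q3 + 2 * q2 + 4 - q1\<^sup>2) = \<zero>"
    "h (q0 + 2 * q3 + 4 - q2\<^sup>2) = \<zero>" "h (q1 + 2 * q0 + 4 - q3\<^sup>2) = \<zero>"
    "h q0 \<noteq> h q2 \<or> h q1 \<noteq> h q3"
proof -
  let ?f = "pappus_steiner R"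
  define P where "P n = (?f ^^ n) z" for n
  have zC: "z \<in> carrier R \<times> carrier R" and off: "off_diagonal (P n)" for n
    using per by (auto simp: PS_has_period_def PS_A_iff P_def)
  have PS: "P (Suc n) = ?f (P n)" for n by (simp add: P_def)
  have PC: "P n \<in> carrier R \<times> carrier R" for n
  proof (induction n)
    case 0 then show ?case using zC by (simp add: P_def)
  next
    case (Suc n) then show ?case using pappus_steiner_closed off PS by simp
  qed
  have P4: "P 4 = P 0" and P2: "P 2 \<noteq> P 0"
    using per by (auto simp: PS_has_period_def P_def)
  \<comment> \<open>All choices depend only on the point \<open>P n\<close>, so periodicity of
    \<open>P\<close> passes literally to \<open>q\<close>.\<close>
  define lift where "lift a = (SOME b. h b = a)" for a
  have lift: "h (lift a) = a" if "a \<in> carrier R" for a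
    unfolding lift_def using that h_range by (metis (mono_tags, lifting) imageE someI_ex)
  define x where "x n = lift (fst (P n))" for n
  define y where "y n = lift (snd (P n))" for n
  define w where "w n = (SOME b. h (lift (snd (P n)) * b - 1) = \<zero>)" for n
  have xy: "P n = (h (x n), h (y n))" for n
    using PC[of n] lift by (auto simp: x_def y_def)
  have hxy: "h (x n) \<noteq> h (y n)" for n
    using off[of n] xy[of n] by (simp add: off_diagonal_def)
  have hy: "h (y n) \<noteq> \<zero>" for n
  proof
    assume y0: "h (y n) = \<zero>"
    \<comment> \<open>A point with y = 0 is sent to the origin, which is on the diagonal.\<close>
    have "pappus_steiner R (h (x n), h (y n)) = (h 0, h 0)"
      unfolding pappus_steiner_eq_iff[OF hxy] using y0 by (simp add: h_mult_eq_0_iff power2_eq_square)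
    then have "P (Suc n) = (h 0, h 0)" using PS xy by simp
    then show False using off[of "Suc n"] by (simp add: off_diagonal_def)
  qed
  have w: "h (y n * w n - 1) = \<zero>" for n
    unfolding w_def y_def[symmetric] using h_inverse[OF hy[of n]] by (rule someI_ex)
  have step: "?f (h (x n), h (y n)) = (h (x (Suc n)), h (y (Suc n)))" for n
    using PS[of n] xy by simp
  define q where "q n = 4 * (x n - y n) * w n" for n
  note st = pappus_steiner_step[OF w w hxy step]
  have A: "h (16 * w (Suc n) - (q n)\<^sup>2) = \<zero>" for n
    by (rule h_lincomb[OF st(1)[of n] st(1)[of n], where x = 16 and y = 0])
       (simp add: q_def algebra_simps power2_eq_square)
  have rel: "h (q (Suc (Suc n)) + 2 * q (Suc n) + 4 - (q n)\<^sup>2) = \<zero>" for n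
    by (rule h_lincomb[OF st(2)[of "Suc n"] A[of n], where x = 1 and y = 1])
       (simp add: q_def algebra_simps)
  have "P (4 + n) = P n" for n
    using P4 unfolding P_def by (simp only: add.commute[of 4] funpow_add o_apply) simp
  then have q4: "q (4 + n) = q n" for n
    unfolding q_def x_def y_def w_def by simp
  \<comment> \<open>Otherwise \<open>w 1 = w 3\<close> in the field, since 16 w is the square of the
    previous q; this gives equal y, then equal x from \<open>q 1 = q 3\<close>. So
    \<open>P 1 = P 3\<close>, and one more step contradicts \<open>P 2 \<noteq> P 0\<close>.\<close>
  have "h (q 0) \<noteq> h (q 2) \<or> h (q 1) \<noteq> h (q 3)"
  proof (rule ccontr)
    assume "\<not> ?thesis"
    then have q02: "h (q 0 - q 2) = \<zero>" and q13: "h (q 1 - q 3) = \<zero>" by (simp_all add: h_eq_iff)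
    have A1: "h (16 * w 1 - (q 0)\<^sup>2) = \<zero>" and A3: "h (16 * w 3 - (q 2)\<^sup>2) = \<zero>"
      using A[of 0] A[of 2] by simp_all
    have "h (2 ^ 4 * (w 1 - w 3)) = \<zero>"
      by (rule h_lincomb3[OF A1 A3 q02, where x = 1 and y = "-1" and z = "q 0 + q 2"])
         (simp add: algebra_simps power2_eq_square)
    then have w13: "h (w 1 - w 3) = \<zero>"
      by (rule h_cancel_power_2[OF h2])
    have y13: "h (y 1 - y 3) = \<zero>"
      by (rule h_lincomb3[OF w13 w[of 3] w[of 1], where x = "- (y 1 * y 3)" and y = "- y 1" and z = "y 3"])
         (simp add: algebra_simps)
    have "h (4 * (x 1 - y 1) * (y 1 * w 1 - 1) - 4 * (x 3 - y 3) * (y 3 * w 3 - 1)) = \<zero>"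
      by (rule h_lincomb[OF w[of 1] w[of 3], where x = "4 * (x 1 - y 1)" and y = "- 4 * (x 3 - y 3)"])
         (simp add: algebra_simps)
    note xw = this
    have "h (2 ^ 2 * (x 1 - x 3)) = \<zero>"
      by (rule h_lincomb3[OF xw q13 y13, where x = "-1" and y = "y 1" and z = "q 3 + 4"])
         (simp add: q_def algebra_simps)
    then have "h (x 1 - x 3) = \<zero>"
      by (rule h_cancel_power_2[OF h2])
    with y13 have "P 1 = P 3" using xy by (simp add: h_eq_iff)
    then have "?f (P 3) = ?f (P 1)" by simp
    then show False using P4 P2 PS[of 3] PS[of 1] by (simp add: numeral_eq_Suc)
  qed
  then show thesis
    using that[of "q 2" "q 1" "q 0" "q 3"] rel[of 0] rel[of 1] rel[of 2] rel[of 3] q4[of 0] q4[of 1]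
    by (simp add: numeral_eq_Suc)
qed

text \<open>With \<open>s = q\<^sub>0 + q\<^sub>2 + 1\<close>, \<open>t = q\<^sub>1 + q\<^sub>3 + 1\<close>, \<open>d = q\<^sub>0 - q\<^sub>2\<close> and \<open>e = q\<^sub>1 - q\<^sub>3\<close> the cycle
  equations become \<open>2 e = s d\<close>, \<open>- 2 d = t e\<close> and two equations for \<open>d\<^sup>2\<close> and \<open>e\<^sup>2\<close>. Hence \<open>s t = -4\<close>,
  and \<open>v = s + t\<close> satisfies \<open>v (v - 1) (v - 3) = 0\<close>.\<close>

lemma cycle_imp_root:
  assumes h2: "h 2 \<noteq> \<zero>"
    and q: "h (q2 + 2 * q1 + 4 - q0\<^sup>2) = \<zero>" "h (q3 + 2 * q2 + 4 - q1\<^sup>2) = \<zero>"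
    "h (q0 + 2 * q3 + 4 - q2\<^sup>2) = \<zero>" "h (q1 + 2 * q0 + 4 - q3\<^sup>2) = \<zero>"
    and ne: "h q0 \<noteq> h q2 \<or> h q1 \<noteq> h q3"
  shows "\<exists>d. h (d\<^sup>2 - 5) = \<zero> \<or> h (d ^ 4 - 17 * d\<^sup>2 + 68) = \<zero>"
proof -
  define s t d e v where "s = q0 + q2 + 1" and "t = q1 + q3 + 1" and "d = q0 - q2" and "e = q1 - q3"
    and "v = s + t"
  note defs = s_def t_def d_def e_def v_def
  have f1: "h (2 * e - s * d) = \<zero>"
    by (rule h_lincomb[OF q(1,3), where x = 1 and y = "-1"]) (simp add: defs algebra_simps power2_eq_square)
  have f2: "h (2 * d + t * e) = \<zero>"
    by (rule h_lincomb[OF q(2,4), where x = "-1" and y = 1]) (simp add: defs algebra_simps power2_eq_square)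
  have d: "h d \<noteq> \<zero>"
  proof
    assume d0: "h d = \<zero>"
    then have "h (2 * e) = \<zero>"
      by (rule h_lincomb[OF f1, where x = 1 and y = s]) simp
    with h2 have "h e = \<zero>" by (simp add: h_mult_eq_0_iff)
    with ne d0 show False by (simp add: defs h_eq_iff)
  qed
  have "h (d * (s * t + 4)) = \<zero>"
    by (rule h_lincomb[OF f1 f2, where x = "- t" and y = 2]) (simp add: algebra_simps)
  with d have st: "h (s * t + 4) = \<zero>" by (simp add: h_mult_eq_0_iff)
  have f3: "h (d\<^sup>2 - 4 * v - 9 + s\<^sup>2) = \<zero>"
    by (rule h_lincomb[OF q(1,3), where x = "-2" and y = "-2"]) (simp add: defs algebra_simps power2_eq_square)
  have f4: "h (e\<^sup>2 - 4 * v - 9 + t\<^sup>2) = \<zero>"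
    by (rule h_lincomb[OF q(2,4), where x = "-2" and y = "-2"]) (simp add: defs algebra_simps power2_eq_square)
  have h4: "h 4 \<noteq> \<zero>"
    using h2 h_mult_eq_0_iff[of 2 2] by simp
  have s: "h s \<noteq> \<zero>"
  proof
    assume "h s = \<zero>"
    then have "h 4 = \<zero>"
      by (rule h_lincomb[OF st, where x = 1 and y = "- t"]) (simp add: algebra_simps)
    with h4 show False by simp
  qed
  \<comment> \<open>This is \<open>4 * e^2 = s^2 * d^2\<close> with both squares replaced by
    \<open>f3\<close> and \<open>f4\<close>.\<close>
  have f5: "h (4 * (4 * v + 9 - t\<^sup>2) - s\<^sup>2 * (4 * v + 9 - s\<^sup>2)) = \<zero>"
    by (rule h_lincomb3[OF f1 f3 f4, where x = "2 * e + s * d" and y = "s\<^sup>2" and z = "-4"])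
       (simp add: algebra_simps power2_eq_square)
  \<comment> \<open>Replace the leading 4 by \<open>- s * t\<close>, take out \<open>s\<close>, and
    use \<open>s^3 + t^3 = v^3 + 12 * v\<close>.\<close>
  have "h (s * (v * ((v - 1) * (v - 3)))) = \<zero>"
    by (rule h_lincomb[OF f5 st, where x = 1 and y = "3 * s\<^sup>2 + 3 * (s * t - 4) + t\<^sup>2 - 8 * s - 4 * t + 3 + 4 * s"])
       (simp add: v_def algebra_simps power2_eq_square)
  with s consider "h v = \<zero>" | "h (v - 1) = \<zero>" | "h (v - 3) = \<zero>"
    by (auto simp: h_mult_eq_0_iff)
  then show ?thesis
  proof cases
    case 1
    have "h (d\<^sup>2 - 5) = \<zero>"
      by (rule h_lincomb3[OF 1 f3 st, where x = "4 - s" and y = 1 and z = 1])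
         (simp add: v_def algebra_simps power2_eq_square)
    then show ?thesis by blast
  next
    \<comment> \<open>Now \<open>s^2 = s + 4\<close>, so \<open>d^2 = 9 - s\<close>; eliminating
      \<open>s\<close> yields the quartic.\<close>
    case 2
    have m: "h (d\<^sup>2 - 9 + s) = \<zero>"
      by (rule h_lincomb3[OF 2 f3 st, where x = "4 - s" and y = 1 and z = 1])
         (simp add: v_def algebra_simps power2_eq_square)
    have "h (d ^ 4 - 17 * d\<^sup>2 + 68) = \<zero>"
      by (rule h_lincomb3[OF 2 m st, where x = s and y = "d\<^sup>2 - s - 8" and z = "-1"])
         (simp add: v_def algebra_simps power2_eq_square power4_eq_xxxx)
    then show ?thesis by blast
  next
    \<comment> \<open>Sum 3 and product -4 leave {-1, 4} for \<open>s\<close> and \<open>t\<close>.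
      Whichever of them is 4, the corresponding difference \<open>d\<close> or \<open>e\<close> has
      square 5.\<close>
    case 3
    have "h ((s - 4) * (s + 1)) = \<zero>"
      by (rule h_lincomb[OF 3 st, where x = s and y = "-1"]) (simp add: v_def algebra_simps)
    then consider "h (s - 4) = \<zero>" | "h (s + 1) = \<zero>" by (auto simp: h_mult_eq_0_iff)
    then show ?thesis
    proof cases
      case 1
      have "h (d\<^sup>2 - 5) = \<zero>"
        by (rule h_lincomb3[OF 3 f3 1, where x = 4 and y = 1 and z = "- (s + 4)"])
           (simp add: algebra_simps power2_eq_square)
      then show ?thesis by blast
    next
      case 2
      have "h (t - 4) = \<zero>"
        by (rule h_lincomb[OF 3 2, where x = 1 and y = "-1"]) (simp add: v_def)
      then have "h (e\<^sup>2 - 5) = \<zero>"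
        by (rule h_lincomb3[OF 3 f4, where x = 4 and y = 1 and z = "- (t + 4)"])
           (simp add: algebra_simps power2_eq_square)
      then show ?thesis by blast
    qed
  qed
qed

section \<open>From a cycle back to a point of period 4\<close>

lemma h_factors_neq_0:
  assumes "h (a * b - c) = \<zero>" "h c \<noteq> \<zero>"
  shows "h a \<noteq> \<zero>" "h b \<noteq> \<zero>"
proof -
  have "h (a * b) \<noteq> \<zero>" using assms h_eq_iff by metis
  then show "h a \<noteq> \<zero>" "h b \<noteq> \<zero>" by (simp_all add: h_mult_eq_0_iff)
qed

lemma h_1_neq_0: "h 1 \<noteq> \<zero>" "h (- 1) \<noteq> \<zero>"
proof -
  show 1: "h 1 \<noteq> \<zero>" by (simp add: h_1)
  have "h (- 1 * - 1 - 1) = \<zero>" by (simp add: h_0)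
  then show "h (- 1) \<noteq> \<zero>" by (rule h_factors_neq_0(1)[OF _ 1])
qed

text \<open>The point with current value \<open>q = b\<close> whose predecessor has
  \<open>q = 1/u\<close>: the step relations force \<open>y = 16 * u^2\<close> and
  \<open>x = y + b * y / 4\<close>.\<close>

definition cycle_point :: "'b \<Rightarrow> 'b \<Rightarrow> 'a \<times> 'a" where
  "cycle_point u b = (h (16 * u\<^sup>2 + 4 * b * u\<^sup>2), h (16 * u\<^sup>2))"

lemma pappus_steiner_cycle_point:
  assumes h2: "h 2 \<noteq> \<zero>" and u: "h (a * u - 1) = \<zero>" and v: "h (b * v - 1) = \<zero>"
    and c: "h (c + 2 * b + 4 - a\<^sup>2) = \<zero>"
  shows "off_diagonal (cycle_point u b)"
    and "pappus_steiner R (cycle_point u b) = cycle_point v c"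
proof -
  have "h (b * (u * u)) \<noteq> \<zero>"
    using h_factors_neq_0(1)[OF v h_1_neq_0(1)] h_factors_neq_0(2)[OF u h_1_neq_0(1)]
    by (simp add: h_mult_eq_0_iff)
  then have "h (2 ^ 2 * (b * (u * u))) \<noteq> \<zero>"
    using h_cancel_power_2[OF h2, of 2 "b * (u * u)"] by metis
  then have ne: "h (16 * u\<^sup>2 + 4 * b * u\<^sup>2) \<noteq> h (16 * u\<^sup>2)"
    by (simp add: h_eq_iff power2_eq_square mult.assoc)
  then show "off_diagonal (cycle_point u b)"
    by (simp add: cycle_point_def off_diagonal_def)
  show "pappus_steiner R (cycle_point u b) = cycle_point v c"
    unfolding cycle_point_def pappus_steiner_eq_iff[OF ne]
  proof
    show "h (2 * (16 * u\<^sup>2) * (16 * u\<^sup>2 - (16 * u\<^sup>2 + 4 * b * u\<^sup>2) + 2)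
        - (16 * v\<^sup>2 + 4 * c * v\<^sup>2) * (16 * u\<^sup>2 + 4 * b * u\<^sup>2 - 16 * u\<^sup>2)\<^sup>2) = \<zero>"
      by (rule h_lincomb3[OF u v c, where x = "- 64 * u\<^sup>2 * (a * u + 1)"
            and y = "- 16 * u ^ 4 * (4 * a\<^sup>2 - 8 * b) * (b * v + 1)" and z = "- 64 * b\<^sup>2 * v\<^sup>2 * u ^ 4"])
         (simp add: algebra_simps power2_eq_square power4_eq_xxxx)
    show "h ((16 * u\<^sup>2)\<^sup>2 - 16 * v\<^sup>2 * (16 * u\<^sup>2 + 4 * b * u\<^sup>2 - 16 * u\<^sup>2)\<^sup>2) = \<zero>"
      by (rule h_lincomb[OF v v, where x = "- 256 * u ^ 4 * (b * v + 1)" and y = 0])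
         (simp add: algebra_simps power2_eq_square power4_eq_xxxx)
  qed
qed

text \<open>Each point of the orbit combines an entry of the cycle with the inverse of its
  predecessor. Nonzero entries provide the inverses and keep the orbit off the diagonal.\<close>

lemma cycle_imp_period4:
  assumes h2: "h 2 \<noteq> \<zero>"
    and q: "h (q2 + 2 * q1 + 4 - q0\<^sup>2) = \<zero>" "h (q3 + 2 * q2 + 4 - q1\<^sup>2) = \<zero>"
    "h (q0 + 2 * q3 + 4 - q2\<^sup>2) = \<zero>" "h (q1 + 2 * q0 + 4 - q3\<^sup>2) = \<zero>"
    and nz: "h q0 \<noteq> \<zero>" "h q1 \<noteq> \<zero>" "h q2 \<noteq> \<zero>" "h q3 \<noteq> \<zero>"
    and ne: "h q0 \<noteq> h q2"
  shows "\<exists>z. PS_has_period R z 4"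
proof -
  obtain u0 u1 u2 u3 where u: "h (q0 * u0 - 1) = \<zero>" "h (q1 * u1 - 1) = \<zero>"
      "h (q2 * u2 - 1) = \<zero>" "h (q3 * u3 - 1) = \<zero>"
    using h_inverse nz by metis
  let ?f = "pappus_steiner R"
  let ?z0 = "cycle_point u1 q2" and ?z1 = "cycle_point u2 q3"
    and ?z2 = "cycle_point u3 q0" and ?z3 = "cycle_point u0 q1"
  note step = pappus_steiner_cycle_point[OF h2]
  note s = step(2)[OF u(2,3) q(2)] step(2)[OF u(3,4) q(3)] step(2)[OF u(4,1) q(4)] step(2)[OF u(1,2) q(1)]
  note off = step(1)[OF u(2,3) q(2)] step(1)[OF u(3,4) q(3)] step(1)[OF u(4,1) q(4)] step(1)[OF u(1,2) q(1)]
  have orbit: "(?f ^^ n) ?z0 \<in> {?z0, ?z1, ?z2, ?z3}" for n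
    by (induction n) (auto simp: s)
  have "?z0 \<in> carrier R \<times> carrier R" by (simp add: cycle_point_def)
  then have A: "?z0 \<in> PS_A R"
    unfolding PS_A_iff using orbit off by (metis empty_iff insert_iff)
  have ne2: "?z2 \<noteq> ?z0"
  proof
    assume "?z2 = ?z0"
    then have e1: "h (16 * u3\<^sup>2 + 4 * q0 * u3\<^sup>2 - (16 * u1\<^sup>2 + 4 * q2 * u1\<^sup>2)) = \<zero>"
      and e2: "h (16 * u3\<^sup>2 - 16 * u1\<^sup>2) = \<zero>"
      unfolding cycle_point_def by (simp_all only: prod.inject h_eq_iff)
    have "h (2 ^ 4 * (u1 * u1 * (q2 - q0))) = \<zero>"
      by (rule h_lincomb[OF e1 e2, where x = "-4" and y = "4 + q0"])
         (simp add: algebra_simps power2_eq_square)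
    then have "h (u1 * u1 * (q2 - q0)) = \<zero>"
      by (rule h_cancel_power_2[OF h2])
    moreover have "h u1 \<noteq> \<zero>"
      by (fact h_factors_neq_0(2)[OF u(2) h_1_neq_0(1)])
    ultimately have "h (q2 - q0) = \<zero>" by (simp add: h_mult_eq_0_iff)
    with ne show False by (simp add: h_eq_iff[symmetric])
  qed
  \<comment> \<open>In a closed chain of four steps a return after 1 or 3 steps forces a fixed
    point, hence a return after 2 steps, which \<open>ne2\<close> excludes.\<close>
  have "(?f ^^ m) ?z0 \<noteq> ?z0" if "0 < m" "m < 4" for m
  proof -
    from that consider "m = 1" | "m = 2" | "m = 3" by linarith
    then show ?thesis
    proof cases
      case 1
      have "?z1 \<noteq> ?z0" using ne2 s(1,2) by auto
      with 1 s show ?thesis by simp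
    next
      case 2
      with ne2 s show ?thesis by (simp add: numeral_2_eq_2)
    next
      case 3
      have "?z3 \<noteq> ?z0" using ne2 s by metis
      with 3 s show ?thesis by (simp add: numeral_3_eq_3)
    qed
  qed
  moreover have "(?f ^^ 4) ?z0 = ?z0" using s by (simp add: eval_nat_numeral)
  ultimately show ?thesis
    using A unfolding PS_has_period_def by (intro exI[of _ ?z0]) auto
qed

lemma exists_half:
  assumes "h 2 \<noteq> \<zero>"
  shows "\<exists>e. h (2 * e + 1 - d) = \<zero>"
proof -
  obtain t where t: "h (2 * t - 1) = \<zero>" using h_inverse[OF assms] by blast
  have "h (2 * (t * (d - 1)) + 1 - d) = \<zero>"
    by (rule h_lincomb[OF t t, where x = "d - 1" and y = 0]) (simp add: algebra_simps)
  then show ?thesis by blast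
qed

text \<open>Writing \<open>d = 2 e + 1\<close> clears the denominators of the cycle recovered from \<open>d = q\<^sub>0 - q\<^sub>2\<close>.\<close>

lemma period4_if_sqrt_5:
  assumes h2: "h 2 \<noteq> \<zero>" and h5: "h 5 \<noteq> \<zero>" and d: "h (d\<^sup>2 - 5) = \<zero>"
  shows "\<exists>z. PS_has_period R z 4"
proof -
  obtain e where e: "h (2 * e + 1 - d) = \<zero>" using exists_half[OF h2] by blast
  have "h (2 ^ 2 * (e\<^sup>2 + e - 1)) = \<zero>"
    by (rule h_lincomb[OF e d, where x = "2 * e + 1 + d" and y = 1])
       (simp add: algebra_simps power2_eq_square)
  then have g: "h (e\<^sup>2 + e - 1) = \<zero>"
    by (rule h_cancel_power_2[OF h2])
  \<comment> \<open>The cycle is \<open>1 + e, e - 1, - e, - e - 2\<close>: the case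
    \<open>v = 0\<close>, \<open>s = 2\<close>, \<open>t = -2\<close>. Opposite entries have product
    -1 and 1, so all are nonzero.\<close>
  have q02: "h ((1 + e) * (- e) - (- 1)) = \<zero>"
    by (rule h_lincomb[OF g g, where x = "-1" and y = 0]) (simp add: algebra_simps power2_eq_square)
  have q13: "h ((e - 1) * (- e - 2) - 1) = \<zero>"
    by (rule h_lincomb[OF g g, where x = "-1" and y = 0]) (simp add: algebra_simps power2_eq_square)
  have "h (1 + e - (- e)) \<noteq> \<zero>"
  proof
    assume k: "h (1 + e - (- e)) = \<zero>"
    have "h 5 = \<zero>"
      by (rule h_lincomb[OF k g, where x = "2 * e + 1" and y = "-4"])
         (simp add: algebra_simps power2_eq_square)
    with h5 show False by simp
  qed
  then have ne: "h (1 + e) \<noteq> h (- e)" by (simp only: h_eq_iff not_False_eq_True)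
  show ?thesis
  proof (rule cycle_imp_period4[OF h2 _ _ _ _ h_factors_neq_0(1)[OF q02 h_1_neq_0(2)] h_factors_neq_0(1)[OF q13 h_1_neq_0(1)]
        h_factors_neq_0(2)[OF q02 h_1_neq_0(2)] h_factors_neq_0(2)[OF q13 h_1_neq_0(1)] ne])
  qed (rule h_lincomb[OF g g, where x = "-1" and y = 0], simp add: algebra_simps power2_eq_square)+
qed

lemma period4_if_quartic_root:
  assumes h2: "h 2 \<noteq> \<zero>" and h17: "h 17 \<noteq> \<zero>" and d: "h (d ^ 4 - 17 * d\<^sup>2 + 68) = \<zero>"
  shows "\<exists>z. PS_has_period R z 4"
proof -
  obtain e where e: "h (2 * e + 1 - d) = \<zero>" using exists_half[OF h2] by blast
  have "h (2 ^ 2 * (4 * e ^ 4 + 8 * e ^ 3 - 11 * e\<^sup>2 - 15 * e + 13)) = \<zero>"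
    by (rule h_lincomb[OF e d, where x = "(2 * e + 1 + d) * ((2 * e + 1)\<^sup>2 + d\<^sup>2 - 17)" and y = 1])
       (simp add: algebra_simps power2_eq_square power3_eq_cube power4_eq_xxxx)
  then have g: "h (4 * e ^ 4 + 8 * e ^ 3 - 11 * e\<^sup>2 - 15 * e + 13) = \<zero>"
    by (rule h_cancel_power_2[OF h2])
  note ring_simps = algebra_simps power2_eq_square power3_eq_cube power4_eq_xxxx
  \<comment> \<open>The case \<open>v = 1\<close>: \<open>s = 9 - d^2\<close>,
    \<open>t = d^2 - 8\<close>, with differences \<open>d\<close> and \<open>s * d / 2\<close>,
    written in terms of \<open>e\<close>.\<close>
  let ?q0 = "4 - 2 * e\<^sup>2 - e" and ?q1 = "- 2 * e ^ 3 - e\<^sup>2 + 5 * e - 2"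
    and ?q2 = "3 - 2 * e\<^sup>2 - 3 * e" and ?q3 = "2 * e ^ 3 + 5 * e\<^sup>2 - e - 6"
  have q02: "h (?q0 * ?q2 - (- 1)) = \<zero>"
    by (rule h_lincomb[OF g g, where x = 1 and y = 0]) (simp add: ring_simps)
  have q13: "h (?q1 * ?q3 - (- 1)) = \<zero>"
    by (rule h_lincomb[OF g g, where x = "1 - e - e\<^sup>2" and y = 0]) (simp add: ring_simps)
  have "h (?q0 - ?q2) \<noteq> \<zero>"
  proof
    assume k: "h (?q0 - ?q2) = \<zero>"
    \<comment> \<open>Equal entries mean \<open>d = 0\<close>, and the quartic then leaves its
      constant term 68 = 4 * 17.\<close>
    have "h (2 ^ 2 * 17) = \<zero>"
      by (rule h_lincomb[OF k g, where x = "- ((2 * e + 1) ^ 3 - 17 * (2 * e + 1))" and y = 4])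
         (simp add: ring_simps)
    with h17 h_cancel_power_2[OF h2, of 2 17] show False by metis
  qed
  then have ne: "h ?q0 \<noteq> h ?q2" by (simp only: h_eq_iff not_False_eq_True)
  show ?thesis
  proof (rule cycle_imp_period4[OF h2 _ _ _ _ h_factors_neq_0(1)[OF q02 h_1_neq_0(2)] h_factors_neq_0(1)[OF q13 h_1_neq_0(2)]
        h_factors_neq_0(2)[OF q02 h_1_neq_0(2)] h_factors_neq_0(2)[OF q13 h_1_neq_0(2)] ne])
    show "h (?q2 + 2 * ?q1 + 4 - ?q0\<^sup>2) = \<zero>"
      by (rule h_lincomb[OF g g, where x = "-1" and y = 0]) (simp add: ring_simps)
    show "h (?q3 + 2 * ?q2 + 4 - ?q1\<^sup>2) = \<zero>"
      by (rule h_lincomb[OF g g, where x = "e - e\<^sup>2" and y = 0]) (simp add: ring_simps)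
    show "h (?q0 + 2 * ?q3 + 4 - ?q2\<^sup>2) = \<zero>"
      by (rule h_lincomb[OF g g, where x = "-1" and y = 0]) (simp add: ring_simps)
    show "h (?q1 + 2 * ?q0 + 4 - ?q3\<^sup>2) = \<zero>"
      by (rule h_lincomb[OF g g, where x = "- 2 - 3 * e - e\<^sup>2" and y = 0]) (simp add: ring_simps)
  qed
qed

lemma period4_iff:
  assumes "h 2 \<noteq> \<zero>" "h 5 \<noteq> \<zero>" "h 17 \<noteq> \<zero>"
  shows "(\<exists>z. PS_has_period R z 4) \<longleftrightarrow>
    (\<exists>d. h (d\<^sup>2 - 5) = \<zero>) \<or> (\<exists>d. h (d ^ 4 - 17 * d\<^sup>2 + 68) = \<zero>)"
proof
  assume "\<exists>z. PS_has_period R z 4"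
  then obtain z where z: "PS_has_period R z 4" by blast
  obtain q0 q1 q2 q3 where
    "h (q2 + 2 * q1 + 4 - q0\<^sup>2) = \<zero>" "h (q3 + 2 * q2 + 4 - q1\<^sup>2) = \<zero>"
    "h (q0 + 2 * q3 + 4 - q2\<^sup>2) = \<zero>" "h (q1 + 2 * q0 + 4 - q3\<^sup>2) = \<zero>"
    "h q0 \<noteq> h q2 \<or> h q1 \<noteq> h q3"
    by (rule period4_imp_cycle[OF assms(1) z])
  from cycle_imp_root[OF assms(1) this]
  show "(\<exists>d. h (d\<^sup>2 - 5) = \<zero>) \<or> (\<exists>d. h (d ^ 4 - 17 * d\<^sup>2 + 68) = \<zero>)"
    by blast
next
  assume "(\<exists>d. h (d\<^sup>2 - 5) = \<zero>) \<or> (\<exists>d. h (d ^ 4 - 17 * d\<^sup>2 + 68) = \<zero>)"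
  then show "\<exists>z. PS_has_period R z 4"
    using period4_if_sqrt_5[OF assms(1,2)] period4_if_quartic_root[OF assms(1,3)] by blast
qed

end

section \<open>The rational numbers and the prime fields\<close>

lemma rat_square_neq_prime:
  fixes d :: rat and p :: int
  assumes "Factorial_Ring.prime p"
  shows "d\<^sup>2 \<noteq> of_int p"
proof
  assume d: "d\<^sup>2 = of_int p"
  obtain a b where ab: "quotient_of d = (a, b)" by fastforce
  then have cop: "coprime a b" and b: "b > 0" and q: "d = of_int a / of_int b"
    using quotient_of_coprime quotient_of_denom_pos quotient_of_div by blast+
  have "(of_int (a\<^sup>2) :: rat) = of_int (p * b\<^sup>2)"
    using d b unfolding q by (simp add: power_divide divide_eq_eq)
  then have eq: "a\<^sup>2 = p * b\<^sup>2" by (simp only: of_int_eq_iff)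
  then have "p dvd a" using assms by (metis dvd_triv_left prime_dvd_power)
  then obtain c where c: "a = p * c" ..
  have "p * (p * c\<^sup>2) = p * b\<^sup>2" using eq c by (simp add: power2_eq_square algebra_simps)
  then have "b\<^sup>2 = p * c\<^sup>2" using assms by auto
  then have "p dvd b" using assms by (metis dvd_triv_left prime_dvd_power)
  with \<open>p dvd a\<close> cop assms show False
    by (meson coprime_common_divisor not_prime_unit)
qed

lemma field_image_rat: "field_image (ring_of_type_algebra :: rat ring) id"
proof -
  interpret Ring.field "ring_of_type_algebra :: rat ring" by (rule field_from_type_algebra)
  show ?thesis by unfold_locales (simp_all add: ring_of_type_algebra_def)
qed

lemma field_image_residue_ring:
  assumes "Factorial_Ring.prime p"
  shows "field_image (residue_ring (int p)) (\<lambda>n. n mod int p)"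
proof -
  interpret residues_prime p "residue_ring (int p)" by unfold_locales (rule assms)
  show ?thesis
  proof unfold_locales
    show "range (\<lambda>n. n mod int p) = carrier (residue_ring (int p))"
      using m_gt_one unfolding res_carrier_eq
      by (auto intro: image_eqI[of x "\<lambda>n. n mod int p" x for x])
  qed (simp_all add: add_cong mult_cong one_cong)
qed

lemma no_rat_period4: "\<not> (\<exists>z. PS_has_period (ring_of_type_algebra :: rat ring) z 4)"
proof -
  interpret field_image "ring_of_type_algebra :: rat ring" id by (rule field_image_rat)
  have zero: "\<zero>\<^bsub>ring_of_type_algebra\<^esub> = (0 :: rat)" by (simp add: ring_of_type_algebra_def)
  have "d\<^sup>2 - 5 \<noteq> 0" for d :: rat
    using rat_square_neq_prime[of 5 d] by simp
  moreover have "d ^ 4 - 17 * d\<^sup>2 + 68 \<noteq> 0" for d :: rat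
  proof
    assume "d ^ 4 - 17 * d\<^sup>2 + 68 = 0"
    \<comment> \<open>Completing the square in \<open>d^2\<close>: a rational root would make 17 a
      rational square.\<close>
    moreover have "(2 * d\<^sup>2 - 17)\<^sup>2 = 4 * (d ^ 4 - 17 * d\<^sup>2 + 68) + 17"
      by (simp add: algebra_simps power2_eq_square power4_eq_xxxx)
    ultimately show False using rat_square_neq_prime[of 17 "2 * d\<^sup>2 - 17"] by simp
  qed
  ultimately show ?thesis
    using period4_iff by (simp add: zero)
qed

lemma residue_ring_period4_iff:
  assumes p: "Factorial_Ring.prime p" "p > 17"
  shows "(\<exists>z. PS_has_period (residue_ring (int p)) z 4) \<longleftrightarrow>
    p mod 5 \<in> {1, 4} \<or> p mod 17 \<in> {1, 4, 13, 16}"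
proof -
  interpret field_image "residue_ring (int p)" "\<lambda>n. n mod int p"
    by (rule field_image_residue_ring[OF p(1)])
  have zero: "\<zero>\<^bsub>residue_ring (int p)\<^esub> = 0" by (simp add: residue_ring_def)
  have "(\<exists>z. PS_has_period (residue_ring (int p)) z 4) \<longleftrightarrow>
      (\<exists>d. int p dvd d\<^sup>2 - 5) \<or> (\<exists>d. int p dvd d ^ 4 - 17 * d\<^sup>2 + 68)"
    using period4_iff p(2) by (simp add: zero dvd_eq_mod_eq_0)
  also have "(\<exists>d. int p dvd d\<^sup>2 - 5) \<longleftrightarrow> QuadRes (int p) 5"
    by (simp add: QuadRes_def cong_iff_dvd_diff)
  finally show ?thesis
    using QuadRes_5[OF p(1)] quartic_root_mod_prime_iff[OF p] p(2) by simp
qed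

theorem theorem4p3:
  shows "\<not> (\<exists>z. PS_has_period (ring_of_type_algebra :: rat ring) z 4) \<and>
         (\<exists>N::nat. \<forall>p::nat. Factorial_Ring.prime p \<and> p > N \<longrightarrow>
            ((\<exists>z. PS_has_period (residue_ring (int p)) z 4) \<longleftrightarrow>
             p mod 5 \<in> {1, 4} \<or> p mod 17 \<in> {1, 4, 13, 16}))"
  \<comment> \<open>The bound \<open>N\<close> is 17; beyond it 2, 5 and 17 are nonzero modulo
    p.\<close>
  using no_rat_period4 residue_ring_period4_iff by blast

end
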